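(* There exists a cop-win oriented graph in which the cop must revisit a vertex in optimal play. That is, in every play of the one-cop game on this graph in which both agents play optimally, the cop returns to some vertex that she had previously occupied and then left.
   Context: All graphs are finite. An oriented graph is a directed graph without loops and without parallel or opposite arcs, i.e. a simple undirected graph each of whose edges has been assigned one direction. Game of cops and robbers with one cop on a digraph: first the cop chooses a starting vertex, then the robber chooses a starting vertex. The game proceeds in rounds: in each round the cop either stays in place or moves along an arc (from its tail to its head), after which the robber either stays in place or moves along an arc. All positions are known to both. The cop wins if after finitely many rounds she occupies the same vertex as the robber; otherwise the robber wins. A digraph is cop-win if one cop has a winning strategy. Optimal play means that the cop attempts to win in as few rounds as possible while the robber attempts to prolong his capture as much as possible (all choices, including starting positions, are made accordingly). *)

theory Defs
  imports "Graph_Theory.Pair_Digraph" "HOL-Library.Extended_Nat"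
begin

definition oriented_graph :: "'v pair_pre_digraph \<Rightarrow> bool" where
  "oriented_graph G \<longleftrightarrow>
     pair_digraph G \<and> (\<forall>u v. (u, v) \<in> parcs G \<longrightarrow> (v, u) \<notin> parcs G)"

definition moves :: "'v pair_pre_digraph \<Rightarrow> 'v \<Rightarrow> 'v set" where
  "moves G u = {v. v = u \<or> (u, v) \<in> parcs G}"

(* A history lists the positions (cop, robber) at the ends of the rounds played so far,
   latest first.  Its oldest entry is the pair of starting vertices ("round 0"), so the
   empty history is the situation in which the cop has to choose her starting vertex. *)

type_synonym 'v history = "('v \<times> 'v) list"

(* The robber also sees the vertex that the cop has just chosen in the current round. *)

type_synonym 'v cop_strategy = "'v history \<Rightarrow> 'v"
type_synonym 'v robber_strategy = "'v history \<Rightarrow> 'v \<Rightarrow> 'v"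

definition cop_strategies :: "'v pair_pre_digraph \<Rightarrow> 'v cop_strategy set" where
  "cop_strategies G = {\<sigma>. \<sigma> [] \<in> pverts G \<and>
     (\<forall>h. \<forall>c \<in> pverts G. \<forall>r \<in> pverts G. \<sigma> ((c, r) # h) \<in> moves G c)}"

definition robber_strategies :: "'v pair_pre_digraph \<Rightarrow> 'v robber_strategy set" where
  "robber_strategies G = {\<tau>. (\<forall>c' \<in> pverts G. \<tau> [] c' \<in> pverts G) \<and>
     (\<forall>h. \<forall>c \<in> pverts G. \<forall>r \<in> pverts G. \<forall>c' \<in> pverts G. \<tau> ((c, r) # h) c' \<in> moves G r)}"

fun play :: "'v cop_strategy \<Rightarrow> 'v robber_strategy \<Rightarrow> nat \<Rightarrow> 'v history" where
  "play \<sigma> \<tau> 0 = []"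
| "play \<sigma> \<tau> (Suc n) = (let h = play \<sigma> \<tau> n; c' = \<sigma> h in (c', \<tau> h c') # h)"

definition cop_pos :: "'v cop_strategy \<Rightarrow> 'v robber_strategy \<Rightarrow> nat \<Rightarrow> 'v" where
  "cop_pos \<sigma> \<tau> k = fst (hd (play \<sigma> \<tau> (Suc k)))"

definition robber_pos :: "'v cop_strategy \<Rightarrow> 'v robber_strategy \<Rightarrow> nat \<Rightarrow> 'v" where
  "robber_pos \<sigma> \<tau> k = snd (hd (play \<sigma> \<tau> (Suc k)))"

(* The agents meet in round k either because the cop moves onto the robber, who is still
   where he was at the end of the previous round, or after the robber's answer.  The
   positions are defined beyond the first meeting, where the game is actually over; they
   are irrelevant, as only the first meeting determines the capture time. *)

definition meet :: "'v cop_strategy \<Rightarrow> 'v robber_strategy \<Rightarrow> nat \<Rightarrow> bool" where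
  "meet \<sigma> \<tau> k \<longleftrightarrow> cop_pos \<sigma> \<tau> k = robber_pos \<sigma> \<tau> k \<or>
     (\<exists>j. k = Suc j \<and> cop_pos \<sigma> \<tau> (Suc j) = robber_pos \<sigma> \<tau> j)"

(* Equal to infinity if the robber is never captured. *)

definition capture_time :: "'v cop_strategy \<Rightarrow> 'v robber_strategy \<Rightarrow> enat" where
  "capture_time \<sigma> \<tau> = (INF k \<in> {k. meet \<sigma> \<tau> k}. enat k)"

definition cop_win :: "'v pair_pre_digraph \<Rightarrow> bool" where
  "cop_win G \<longleftrightarrow>
     (\<exists>\<sigma> \<in> cop_strategies G. \<forall>\<tau> \<in> robber_strategies G. \<exists>k. meet \<sigma> \<tau> k)"

definition optimal_cop :: "'v pair_pre_digraph \<Rightarrow> 'v cop_strategy \<Rightarrow> bool" where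
  "optimal_cop G \<sigma> \<longleftrightarrow> \<sigma> \<in> cop_strategies G \<and>
     (\<forall>\<sigma>' \<in> cop_strategies G.
        (SUP \<tau> \<in> robber_strategies G. capture_time \<sigma> \<tau>)
          \<le> (SUP \<tau> \<in> robber_strategies G. capture_time \<sigma>' \<tau>))"

definition optimal_robber :: "'v pair_pre_digraph \<Rightarrow> 'v robber_strategy \<Rightarrow> bool" where
  "optimal_robber G \<tau> \<longleftrightarrow> \<tau> \<in> robber_strategies G \<and>
     (\<forall>\<tau>' \<in> robber_strategies G.
        (INF \<sigma> \<in> cop_strategies G. capture_time \<sigma> \<tau>')
          \<le> (INF \<sigma> \<in> cop_strategies G. capture_time \<sigma> \<tau>))"

definition cop_revisits :: "'v cop_strategy \<Rightarrow> 'v robber_strategy \<Rightarrow> bool" where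
  "cop_revisits \<sigma> \<tau> \<longleftrightarrow>
     (\<exists>i j k. i < j \<and> j < k \<and> enat k \<le> capture_time \<sigma> \<tau> \<and>
        cop_pos \<sigma> \<tau> j \<noteq> cop_pos \<sigma> \<tau> i \<and> cop_pos \<sigma> \<tau> k = cop_pos \<sigma> \<tau> i)"

end

theory Submission
  imports Defs
begin

text \<open>
  Optimality here only constrains worst-case capture times, so a strategy may err where the
  opponent never takes it.  Still, when both agents are optimal, the number of rounds in which
  the cop can enforce capture drops by exactly one in each round of the actual play: otherwise
  one agent could be redirected at a single history and break the guarantee of the other one.

  The example consists of two directed triangles \<open>1 \<rightarrow> 2 \<rightarrow> 3 \<rightarrow> 1\<close> and \<open>4 \<rightarrow> 5 \<rightarrow> 6 \<rightarrow> 4\<close>, the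
  connecting arcs \<open>1 \<rightarrow> 4\<close>, \<open>1 \<rightarrow> 6\<close>, \<open>2 \<rightarrow> 6\<close>, \<open>3 \<rightarrow> 5\<close>, \<open>4 \<rightarrow> 2\<close>, and a source \<open>0\<close> with arcs to the
  first triangle.  Its value is 5.  The cop starts at \<open>0\<close> and goes around the first triangle as
  \<open>1, 2, 3, 1\<close>, which drives the robber from \<open>4\<close> over \<open>5\<close> to \<open>6\<close>; she wins only after returning
  to \<open>1\<close>, from where she attacks both \<open>6\<close> and \<open>4\<close>, the only vertex to which he could flee.
\<close>

section \<open>Plays and capture times\<close>

declare play.simps(2) [simp del]

lemma play_Suc:
  "play \<sigma> \<tau> (Suc k) = (cop_pos \<sigma> \<tau> k, robber_pos \<sigma> \<tau> k) # play \<sigma> \<tau> k"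
  by (simp add: play.simps(2) cop_pos_def robber_pos_def Let_def)

lemma cop_pos_eq: "cop_pos \<sigma> \<tau> k = \<sigma> (play \<sigma> \<tau> k)"
  by (simp add: play.simps(2) cop_pos_def Let_def)

lemma robber_pos_eq: "robber_pos \<sigma> \<tau> k = \<tau> (play \<sigma> \<tau> k) (cop_pos \<sigma> \<tau> k)"
  by (simp add: play.simps(2) cop_pos_def robber_pos_def Let_def)

lemma length_play [simp]: "length (play \<sigma> \<tau> k) = k"
  by (induction k) (simp_all add: play_Suc)

lemma meet_0: "meet \<sigma> \<tau> 0 \<longleftrightarrow> cop_pos \<sigma> \<tau> 0 = robber_pos \<sigma> \<tau> 0"
  by (simp add: meet_def)

lemma meet_Suc:
  "meet \<sigma> \<tau> (Suc k) \<longleftrightarrow> cop_pos \<sigma> \<tau> (Suc k) = robber_pos \<sigma> \<tau> (Suc k) \<or>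
    cop_pos \<sigma> \<tau> (Suc k) = robber_pos \<sigma> \<tau> k"
  by (simp add: meet_def)

text \<open>A nonempty set of naturals attains its infimum and the empty one yields infinity, so a
  finite bound always speaks of an actual meeting.\<close>

lemma capture_time_le_iff: "capture_time \<sigma> \<tau> \<le> enat n \<longleftrightarrow> (\<exists>k\<le>n. meet \<sigma> \<tau> k)"
proof
  assume le: "capture_time \<sigma> \<tau> \<le> enat n"
  show "\<exists>k\<le>n. meet \<sigma> \<tau> k"
  proof (rule ccontr)
    assume "\<not> (\<exists>k\<le>n. meet \<sigma> \<tau> k)"
    then have "enat (Suc n) \<le> capture_time \<sigma> \<tau>"
      unfolding capture_time_def by (intro INF_greatest) (auto simp: not_le Suc_le_eq)
    with le have "enat (Suc n) \<le> enat n"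
      by (rule order_trans[rotated])
    then show False
      by simp
  qed
next
  assume "\<exists>k\<le>n. meet \<sigma> \<tau> k"
  then show "capture_time \<sigma> \<tau> \<le> enat n"
    unfolding capture_time_def by (auto intro: INF_lower2)
qed

text \<open>The first \<open>k\<close> entries of a play consult the strategies only at histories
  shorter than \<open>k\<close>, so changes at longer histories come too late to matter.\<close>

lemma play_cong:
  assumes "\<And>h. length h < n \<Longrightarrow> \<sigma>' h = \<sigma> h" "\<And>h. length h < n \<Longrightarrow> \<tau>' h = \<tau> h" "k \<le> n"
  shows "play \<sigma>' \<tau>' k = play \<sigma> \<tau> k"
  using assms(3) by (induction k) (simp_all add: play.simps(2) Let_def assms(1,2))

lemma meet_cong:
  assumes "\<And>j. j \<le> Suc k \<Longrightarrow> play \<sigma>' \<tau>' j = play \<sigma> \<tau> j" "j \<le> k"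
  shows "meet \<sigma>' \<tau>' j \<longleftrightarrow> meet \<sigma> \<tau> j"
  using assms by (auto simp: meet_def cop_pos_def robber_pos_def)


section \<open>Positions from which the cop wins within a given number of rounds\<close>

text \<open>Backward induction with the cop to move. The case \<open>c' = r\<close> is a capture
  before the robber can answer, which still costs a round.\<close>

fun captures_within :: "'v pair_pre_digraph \<Rightarrow> nat \<Rightarrow> 'v \<Rightarrow> 'v \<Rightarrow> bool" where
  "captures_within G 0 c r \<longleftrightarrow> c = r"
| "captures_within G (Suc n) c r \<longleftrightarrow> c = r \<or>
     (\<exists>c' \<in> moves G c. c' = r \<or> (\<forall>r' \<in> moves G r. captures_within G n c' r'))"

lemma moves_self: "u \<in> moves G u"
  by (simp add: moves_def)

context
  fixes G :: "'v pair_pre_digraph"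
  assumes wf: "pair_wf_digraph G"
begin

lemma moves_pverts: "u \<in> pverts G \<Longrightarrow> v \<in> moves G u \<Longrightarrow> v \<in> pverts G"
  using wf by (auto simp: moves_def dest: pair_wf_digraph.in_arcsD2)

text \<open>Strategies are constrained only at histories whose latest entry consists of vertices, so
  legality has to be carried along the play.\<close>

lemma pos_pverts:
  assumes "\<sigma> \<in> cop_strategies G" "\<tau> \<in> robber_strategies G"
  shows "cop_pos \<sigma> \<tau> k \<in> pverts G \<and> robber_pos \<sigma> \<tau> k \<in> pverts G"
proof (induction k)
  case 0
  then show ?case
    using assms by (simp add: cop_pos_eq robber_pos_eq cop_strategies_def robber_strategies_def)
next
  case (Suc k)
  then have "cop_pos \<sigma> \<tau> (Suc k) \<in> moves G (cop_pos \<sigma> \<tau> k)"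
    using assms(1) by (simp add: cop_pos_eq[of _ _ "Suc k"] play_Suc cop_strategies_def)
  moreover from this have "cop_pos \<sigma> \<tau> (Suc k) \<in> pverts G"
    using Suc moves_pverts by blast
  then have "robber_pos \<sigma> \<tau> (Suc k) \<in> moves G (robber_pos \<sigma> \<tau> k)"
    using assms(2) Suc by (simp add: robber_pos_eq[of _ _ "Suc k"] play_Suc robber_strategies_def)
  ultimately show ?case
    using Suc moves_pverts by blast
qed

lemma cop_pos_Suc:
  assumes "\<sigma> \<in> cop_strategies G" "\<tau> \<in> robber_strategies G"
  shows "cop_pos \<sigma> \<tau> (Suc k) \<in> moves G (cop_pos \<sigma> \<tau> k)"
  using assms pos_pverts[OF assms, of k]
  by (simp add: cop_pos_eq[of _ _ "Suc k"] play_Suc cop_strategies_def)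

lemma robber_pos_Suc:
  assumes "\<sigma> \<in> cop_strategies G" "\<tau> \<in> robber_strategies G"
  shows "robber_pos \<sigma> \<tau> (Suc k) \<in> moves G (robber_pos \<sigma> \<tau> k)"
  using assms pos_pverts[OF assms, of k] pos_pverts[OF assms, of "Suc k"]
  by (simp add: robber_pos_eq[of _ _ "Suc k"] play_Suc robber_strategies_def)

section \<open>Deviations at a single history and their consequences for guarantees\<close>

lemma redirect_robber:
  assumes "\<tau> \<in> robber_strategies G" "r' \<in> moves G (robber_pos \<sigma> \<tau> k)"
  obtains \<tau>' where "\<tau>' \<in> robber_strategies G" "\<And>j. j \<le> Suc k \<Longrightarrow> play \<sigma> \<tau>' j = play \<sigma> \<tau> j"
    "robber_pos \<sigma> \<tau>' (Suc k) = r'"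
proof
  \<comment> \<open>Legal because \<open>robber_pos \<sigma> \<tau> k\<close> is the latest robber
    position in this history. Ignoring the cop's choice is harmless, as \<open>\<sigma>\<close>
    fixes it here.\<close>
  define \<tau>' where "\<tau>' = \<tau>(play \<sigma> \<tau> (Suc k) := (\<lambda>_. r'))"
  show "\<tau>' \<in> robber_strategies G"
    using assms by (auto simp: \<tau>'_def play_Suc robber_strategies_def)
  show same: "play \<sigma> \<tau>' j = play \<sigma> \<tau> j" if "j \<le> Suc k" for j
    using that by (intro play_cong[of "Suc k"]) (auto simp: \<tau>'_def)
  show "robber_pos \<sigma> \<tau>' (Suc k) = r'"
    unfolding robber_pos_eq same[OF order_refl] by (simp add: \<tau>'_def)
qed

lemma redirect_cop:
  assumes "\<sigma> \<in> cop_strategies G" "c' \<in> moves G (cop_pos \<sigma> \<tau> k)"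
  obtains \<sigma>' where "\<sigma>' \<in> cop_strategies G" "\<And>j. j \<le> Suc k \<Longrightarrow> play \<sigma>' \<tau> j = play \<sigma> \<tau> j"
    "cop_pos \<sigma>' \<tau> (Suc k) = c'"
proof
  define \<sigma>' where "\<sigma>' = \<sigma>(play \<sigma> \<tau> (Suc k) := c')"
  show "\<sigma>' \<in> cop_strategies G"
    using assms by (auto simp: \<sigma>'_def play_Suc cop_strategies_def)
  show same: "play \<sigma>' \<tau> j = play \<sigma> \<tau> j" if "j \<le> Suc k" for j
    using that by (intro play_cong[of "Suc k"]) (auto simp: \<sigma>'_def)
  show "cop_pos \<sigma>' \<tau> (Suc k) = c'"
    unfolding cop_pos_eq same[OF order_refl] by (simp add: \<sigma>'_def)
qed

text \<open>The robber may be redirected at any single history, so against a cop who guarantees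
  capture by round \<open>N\<close> every one of his replies leads to a position that she wins in time.\<close>

lemma cop_guarantee_step:
  assumes \<sigma>: "\<sigma> \<in> cop_strategies G"
    and guarantee: "\<And>\<tau>. \<tau> \<in> robber_strategies G \<Longrightarrow> capture_time \<sigma> \<tau> \<le> enat N"
    and "\<tau> \<in> robber_strategies G" "k + Suc n = N" "\<And>j. j \<le> k \<Longrightarrow> \<not> meet \<sigma> \<tau> j"
    and "r' \<in> moves G (robber_pos \<sigma> \<tau> k)"
  shows "cop_pos \<sigma> \<tau> (Suc k) = robber_pos \<sigma> \<tau> k \<or> captures_within G n (cop_pos \<sigma> \<tau> (Suc k)) r'"
  using assms(3-)
proof (induction n arbitrary: \<tau> k r')
  \<comment> \<open>With one round left, the redirected play must meet in round
    \<open>Suc k\<close>: either the cop steps onto the robber before he moves, or the imposed reply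
    \<open>r'\<close> is her vertex.\<close>
  case (0 \<tau> k r')
  obtain \<tau>' where \<tau>': "\<tau>' \<in> robber_strategies G"
    and same: "\<And>j. j \<le> Suc k \<Longrightarrow> play \<sigma> \<tau>' j = play \<sigma> \<tau> j" and r': "robber_pos \<sigma> \<tau>' (Suc k) = r'"
    using redirect_robber[OF 0(1,4)] by blast
  have "\<not> meet \<sigma> \<tau>' j" if "j \<le> k" for j
    using meet_cong[OF same that] 0(3) that by blast
  then have "meet \<sigma> \<tau>' (Suc k)"
    using guarantee[OF \<tau>'] 0(2) by (auto simp: capture_time_le_iff le_Suc_eq)
  moreover have "cop_pos \<sigma> \<tau>' (Suc k) = cop_pos \<sigma> \<tau> (Suc k)" "robber_pos \<sigma> \<tau>' k = robber_pos \<sigma> \<tau> k"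
    using same[of "Suc k"] by (simp add: cop_pos_eq, simp add: play_Suc)
  ultimately show ?case
    using r' by (auto simp: meet_Suc)
next
  case (Suc n \<tau> k r')
  obtain \<tau>' where \<tau>': "\<tau>' \<in> robber_strategies G"
    and same: "\<And>j. j \<le> Suc k \<Longrightarrow> play \<sigma> \<tau>' j = play \<sigma> \<tau> j" and r': "robber_pos \<sigma> \<tau>' (Suc k) = r'"
    using redirect_robber[OF Suc.prems(1,4)] by blast
  have c': "cop_pos \<sigma> \<tau>' (Suc k) = cop_pos \<sigma> \<tau> (Suc k)" "robber_pos \<sigma> \<tau>' k = robber_pos \<sigma> \<tau> k"
    using same[of "Suc k"] by (simp add: cop_pos_eq, simp add: play_Suc)
  show ?case
  proof (cases "meet \<sigma> \<tau>' (Suc k)")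
    case True
    then show ?thesis
      using r' c' by (auto simp: meet_Suc)
  next
    case False
    moreover have "\<not> meet \<sigma> \<tau>' j" if "j \<le> k" for j
      using meet_cong[OF same that] Suc.prems(3) that by blast
    ultimately have "\<not> meet \<sigma> \<tau>' j" if "j \<le> Suc k" for j
      using that by (auto simp: le_Suc_eq)
    \<comment> \<open>The next cop move does not depend on \<open>r''\<close>, so it can serve as
      the common witness against all replies.\<close>
    then have "cop_pos \<sigma> \<tau>' (Suc (Suc k)) = robber_pos \<sigma> \<tau>' (Suc k) \<or>
      captures_within G n (cop_pos \<sigma> \<tau>' (Suc (Suc k))) r''" if "r'' \<in> moves G r'" for r''
      using Suc.IH[OF \<tau>', of "Suc k" r''] Suc.prems(2) r' that by simp
    then show ?thesis
      using cop_pos_Suc[OF \<sigma> \<tau>', of "Suc k"] r' c' by auto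
  qed
qed

lemma cop_guarantee:
  assumes "\<sigma> \<in> cop_strategies G" "\<And>\<tau>. \<tau> \<in> robber_strategies G \<Longrightarrow> capture_time \<sigma> \<tau> \<le> enat N"
    and "\<tau> \<in> robber_strategies G" "k + Suc n = N" "\<And>j. j \<le> k \<Longrightarrow> \<not> meet \<sigma> \<tau> j"
  shows "captures_within G (Suc n) (cop_pos \<sigma> \<tau> k) (robber_pos \<sigma> \<tau> k)"
  using cop_guarantee_step[OF assms] cop_pos_Suc[OF assms(1,3), of k] by auto

text \<open>Otherwise the cop could deviate into winning moves, one history at a time, and meet the
  robber before round \<open>N\<close>, against the guarantee of \<open>\<tau>\<close>.\<close>

lemma robber_guarantee:
  assumes \<tau>: "\<tau> \<in> robber_strategies G"
    and guarantee: "\<And>\<sigma>. \<sigma> \<in> cop_strategies G \<Longrightarrow> enat N \<le> capture_time \<sigma> \<tau>"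
    and "\<sigma> \<in> cop_strategies G" "k + n < N"
  shows "\<not> captures_within G n (cop_pos \<sigma> \<tau> k) (robber_pos \<sigma> \<tau> k)"
  using assms(3-)
proof (induction n arbitrary: \<sigma> k)
  have no_meet: "\<not> meet \<sigma> \<tau> j" if "\<sigma> \<in> cop_strategies G" "j < N" for \<sigma> j
  proof
    assume "meet \<sigma> \<tau> j"
    then have "capture_time \<sigma> \<tau> \<le> enat j"
      by (auto simp: capture_time_le_iff)
    with guarantee[OF that(1)] have "enat N \<le> enat j"
      by (rule order_trans)
    with \<open>j < N\<close> show False
      by simp
  qed
  {
    case (0 \<sigma> k)
    then show ?case
      using no_meet[of \<sigma> k] by (simp add: meet_def)
  next
    case (Suc n \<sigma> k)
    show ?case
    proof
      assume "captures_within G (Suc n) (cop_pos \<sigma> \<tau> k) (robber_pos \<sigma> \<tau> k)"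
      moreover have "cop_pos \<sigma> \<tau> k \<noteq> robber_pos \<sigma> \<tau> k"
        using no_meet[of \<sigma> k] Suc.prems by (simp add: meet_def)
      ultimately obtain c' where c': "c' \<in> moves G (cop_pos \<sigma> \<tau> k)"
        and win: "c' = robber_pos \<sigma> \<tau> k \<or> (\<forall>r' \<in> moves G (robber_pos \<sigma> \<tau> k). captures_within G n c' r')"
        by auto
      obtain \<sigma>' where \<sigma>': "\<sigma>' \<in> cop_strategies G"
        and same: "\<And>j. j \<le> Suc k \<Longrightarrow> play \<sigma>' \<tau> j = play \<sigma> \<tau> j" and pos: "cop_pos \<sigma>' \<tau> (Suc k) = c'"
        using redirect_cop[OF Suc.prems(1) c'] by blast
      have r: "robber_pos \<sigma>' \<tau> k = robber_pos \<sigma> \<tau> k"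
        using same[of "Suc k"] by (simp add: play_Suc)
      have "c' \<noteq> robber_pos \<sigma> \<tau> k"
        using no_meet[OF \<sigma>', of "Suc k"] Suc.prems(2) pos r by (auto simp: meet_Suc)
      \<comment> \<open>The reply of \<open>\<tau>\<close> to the deviation is not known, but
        \<open>c'\<close> wins against every legal reply.\<close>
      with win have "captures_within G n (cop_pos \<sigma>' \<tau> (Suc k)) (robber_pos \<sigma>' \<tau> (Suc k))"
        using robber_pos_Suc[OF \<sigma>' \<tau>, of k] pos r by simp
      then show False
        using Suc.IH[OF \<sigma>', of "Suc k"] Suc.prems(2) by simp
    qed
  }
qed

section \<open>Strategies obtained from the winning positions\<close>

lemma ex_cop_strategy:
  assumes c0: "c0 \<in> pverts G" "\<And>r. r \<in> pverts G \<Longrightarrow> captures_within G N c0 r"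
  obtains \<sigma> where "\<sigma> \<in> cop_strategies G"
    "\<And>\<tau>. \<tau> \<in> robber_strategies G \<Longrightarrow> capture_time \<sigma> \<tau> \<le> enat N"
proof -
  define good where "good n r c' \<longleftrightarrow> c' = r \<or> (\<forall>r' \<in> moves G r. captures_within G n c' r')" for n r c'
  have ex: "\<exists>c'. c' \<in> moves G c \<and> ((\<exists>c'' \<in> moves G c. good n r c'') \<longrightarrow> good n r c')" for n c r
  proof (cases "\<exists>c'' \<in> moves G c. good n r c''")
    case True
    then show ?thesis by blast
  next
    case False
    then show ?thesis using moves_self[of c G] by blast
  qed
  \<comment> \<open>Prefers a winning move but is legal in any case, since staying put is;
    strategies must also be legal at histories that never arise.\<close>
  define next_cop where "next_cop n c r =
    (SOME c'. c' \<in> moves G c \<and> ((\<exists>c'' \<in> moves G c. good n r c'') \<longrightarrow> good n r c'))" for n c r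
  have next_cop: "next_cop n c r \<in> moves G c"
    "\<exists>c'' \<in> moves G c. good n r c'' \<Longrightarrow> good n r (next_cop n c r)" for n c r
    using someI_ex[OF ex[of c n r]] unfolding next_cop_def by blast+
  \<comment> \<open>The starting pair counts towards \<open>length h\<close>, so
    \<open>N - length h\<close> is the number of rounds left after the coming one.\<close>
  define \<sigma> where "\<sigma> h = (case h of [] \<Rightarrow> c0 | (c, r) # h' \<Rightarrow> next_cop (N - length h) c r)" for h
  show thesis
  proof (rule that[of \<sigma>])
    show \<sigma>: "\<sigma> \<in> cop_strategies G"
      using c0(1) next_cop by (auto simp: cop_strategies_def \<sigma>_def)
    show "capture_time \<sigma> \<tau> \<le> enat N" if \<tau>: "\<tau> \<in> robber_strategies G" for \<tau>
    proof (rule ccontr)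
      assume "\<not> capture_time \<sigma> \<tau> \<le> enat N"
      then have no_meet: "\<not> meet \<sigma> \<tau> k" if "k \<le> N" for k
        using that by (auto simp: capture_time_le_iff)
      have "captures_within G (N - k) (cop_pos \<sigma> \<tau> k) (robber_pos \<sigma> \<tau> k)" if "k \<le> N" for k
        using that
      proof (induction k)
        case 0
        have "cop_pos \<sigma> \<tau> 0 = c0"
          by (simp add: cop_pos_eq \<sigma>_def)
        then show ?case
          using c0(2) pos_pverts[OF \<sigma> \<tau>, of 0] by simp
      next
        case (Suc k)
        then have "captures_within G (Suc (N - Suc k)) (cop_pos \<sigma> \<tau> k) (robber_pos \<sigma> \<tau> k)"
          by (simp add: Suc_diff_Suc)
        moreover have "cop_pos \<sigma> \<tau> k \<noteq> robber_pos \<sigma> \<tau> k"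
          using no_meet[of k] Suc.prems by (simp add: meet_def)
        moreover have "cop_pos \<sigma> \<tau> (Suc k) = next_cop (N - Suc k) (cop_pos \<sigma> \<tau> k) (robber_pos \<sigma> \<tau> k)"
          by (simp add: cop_pos_eq[of _ _ "Suc k"] play_Suc \<sigma>_def)
        ultimately have "good (N - Suc k) (robber_pos \<sigma> \<tau> k) (cop_pos \<sigma> \<tau> (Suc k))"
          using next_cop by (auto simp: good_def)
        moreover have "cop_pos \<sigma> \<tau> (Suc k) \<noteq> robber_pos \<sigma> \<tau> k"
          using no_meet[of "Suc k"] Suc.prems by (simp add: meet_Suc)
        ultimately show ?case
          using robber_pos_Suc[OF \<sigma> \<tau>, of k] by (simp add: good_def)
      qed
      from this[of N] have "meet \<sigma> \<tau> N"
        by (simp add: meet_def)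
      then show False
        using no_meet by blast
    qed
  qed
qed

text \<open>Dual construction: while the cop cannot win in the rounds left, each of her moves admits
  a reply that keeps it so. Surviving rounds 0 to \<open>N\<close> gives the bound
  \<open>Suc N\<close>.\<close>

lemma ex_robber_strategy:
  assumes r0: "\<And>c. c \<in> pverts G \<Longrightarrow> \<exists>r \<in> pverts G. \<not> captures_within G N c r"
  obtains \<tau> where "\<tau> \<in> robber_strategies G"
    "\<And>\<sigma>. \<sigma> \<in> cop_strategies G \<Longrightarrow> enat (Suc N) \<le> capture_time \<sigma> \<tau>"
proof -
  have ex: "\<exists>r'. r' \<in> moves G r \<and> ((\<exists>r'' \<in> moves G r. \<not> captures_within G n c' r'') \<longrightarrow>
    \<not> captures_within G n c' r')" for n c' r
  proof (cases "\<exists>r'' \<in> moves G r. \<not> captures_within G n c' r''")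
    case True
    then show ?thesis by blast
  next
    case False
    then show ?thesis using moves_self[of r G] by blast
  qed
  define next_robber where "next_robber n c' r = (SOME r'. r' \<in> moves G r \<and>
    ((\<exists>r'' \<in> moves G r. \<not> captures_within G n c' r'') \<longrightarrow> \<not> captures_within G n c' r'))" for n c' r
  have next_robber: "next_robber n c' r \<in> moves G r"
    "\<exists>r'' \<in> moves G r. \<not> captures_within G n c' r'' \<Longrightarrow>
      \<not> captures_within G n c' (next_robber n c' r)" for n c' r
    using someI_ex[OF ex[of r n c']] unfolding next_robber_def by blast+
  define start where "start c = (SOME r. r \<in> pverts G \<and> \<not> captures_within G N c r)" for c
  have start: "start c \<in> pverts G \<and> \<not> captures_within G N c (start c)" if "c \<in> pverts G" for c
    unfolding start_def by (rule someI_ex) (use r0[OF that] in blast)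
  define \<tau> where "\<tau> h c' = (case h of [] \<Rightarrow> start c' | (c, r) # h' \<Rightarrow> next_robber (N - length h) c' r)"
    for h :: "'v history" and c'
  show thesis
  proof (rule that[of \<tau>])
    show \<tau>: "\<tau> \<in> robber_strategies G"
      using start next_robber by (auto simp: robber_strategies_def \<tau>_def)
    show "enat (Suc N) \<le> capture_time \<sigma> \<tau>" if \<sigma>: "\<sigma> \<in> cop_strategies G" for \<sigma>
    proof -
      have "\<not> meet \<sigma> \<tau> k \<and> \<not> captures_within G (N - k) (cop_pos \<sigma> \<tau> k) (robber_pos \<sigma> \<tau> k)" if "k \<le> N" for k
        using that
      proof (induction k)
        case 0
        have "\<not> captures_within G N (cop_pos \<sigma> \<tau> 0) (robber_pos \<sigma> \<tau> 0)"
          using start pos_pverts[OF \<sigma> \<tau>, of 0] by (simp add: robber_pos_eq \<tau>_def)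
        then show ?case
          by (cases N) (auto simp: meet_0)
      next
        case (Suc k)
        then have "\<not> captures_within G (Suc (N - Suc k)) (cop_pos \<sigma> \<tau> k) (robber_pos \<sigma> \<tau> k)"
          by (simp add: Suc_diff_Suc)
        moreover have "robber_pos \<sigma> \<tau> (Suc k) = next_robber (N - Suc k) (cop_pos \<sigma> \<tau> (Suc k)) (robber_pos \<sigma> \<tau> k)"
          by (simp add: robber_pos_eq[of _ _ "Suc k"] play_Suc \<tau>_def)
        ultimately have "cop_pos \<sigma> \<tau> (Suc k) \<noteq> robber_pos \<sigma> \<tau> k" and
          safe: "\<not> captures_within G (N - Suc k) (cop_pos \<sigma> \<tau> (Suc k)) (robber_pos \<sigma> \<tau> (Suc k))"
          using cop_pos_Suc[OF \<sigma> \<tau>, of k] next_robber(2) by auto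
        \<comment> \<open>Coinciding positions count as won for any number of rounds; the case split
          only unfolds \<open>captures_within\<close>.\<close>
        moreover from safe have "cop_pos \<sigma> \<tau> (Suc k) \<noteq> robber_pos \<sigma> \<tau> (Suc k)"
          by (cases "N - Suc k") auto
        ultimately show ?case
          by (simp add: meet_Suc)
      qed
      then have "\<not> capture_time \<sigma> \<tau> \<le> enat N"
        by (auto simp: capture_time_le_iff)
      then show ?thesis
        by (simp add: not_le Suc_ile_eq)
    qed
  qed
qed

end


section \<open>The graph\<close>

definition out_neighbours :: "nat \<Rightarrow> nat list" where
  "out_neighbours u = [[1, 2, 3], [2, 4, 6], [3, 6], [1, 5], [2, 5], [6], [4]] ! u"

definition example :: "nat pair_pre_digraph" where
  "example = \<lparr>pverts = {..<7}, parcs = {(u, v). u < 7 \<and> v \<in> set (out_neighbours u)}\<rparr>"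

text \<open>Entry \<open>r\<close> of row \<open>c\<close> is the number of rounds that the cop at \<open>c\<close>, who is to move, needs
  to capture the robber at \<open>r\<close>; the entry 9 stands for infinity.\<close>

definition rounds :: "nat \<Rightarrow> nat \<Rightarrow> nat" where
  "rounds c r = [[0, 1, 1, 1, 5, 3, 2],
                 [9, 0, 1, 9, 1, 4, 1],
                 [9, 9, 0, 1, 9, 3, 1],
                 [9, 1, 9, 0, 5, 1, 2],
                 [9, 9, 1, 9, 0, 1, 9],
                 [9, 9, 9, 9, 9, 0, 1],
                 [9, 9, 9, 9, 1, 9, 0]] ! c ! r"

lemma example_pverts: "pverts example = {..<7}"
  by (simp add: example_def)

text \<open>Makes bounded quantifiers executable, so that \<open>code_simp\<close> can decide the
  checks of the table.\<close>

lemma all_less_code: "(\<forall>i<n. P i) \<longleftrightarrow> list_all P [0..<n]"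
  by (auto simp: list_all_iff)

lemma ex_less_code: "(\<exists>i<n. P i) \<longleftrightarrow> list_ex P [0..<n]"
  by (auto simp: list_ex_iff)

lemma oriented_example: "oriented_graph example"
proof -
  have "\<forall>u<7. \<forall>v \<in> set (out_neighbours u). v < 7 \<and> v \<noteq> u \<and> u \<notin> set (out_neighbours v)"
    unfolding all_less_code by code_simp
  then have arc: "u < 7 \<and> v < 7 \<and> v \<noteq> u \<and> (v, u) \<notin> parcs example" if "(u, v) \<in> parcs example" for u v
    using that by (auto simp: example_def)
  have "parcs example \<subseteq> {..<7} \<times> {..<7}"
    using arc by auto
  then have "finite (parcs example)"
    by (rule finite_subset) simp
  then have "pair_digraph example"
    by unfold_locales (auto dest: arc simp: example_pverts)
  then show ?thesis
    using arc by (simp add: oriented_graph_def)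
qed

lemma wf_example: "pair_wf_digraph example"
  using oriented_example by (simp add: oriented_graph_def pair_digraph_def pair_fin_digraph_def)

lemma moves_example: "c < 7 \<Longrightarrow> moves example c = set (c # out_neighbours c)"
  by (auto simp: moves_def example_def)

text \<open>The bound 5 is the value of the game, and it keeps the entry 9 out of reach, so that 9
  acts as infinity.\<close>

lemma captures_within_example:
  assumes "n \<le> 5" "c < 7" "r < 7"
  shows "captures_within example n c r \<longleftrightarrow> rounds c r \<le> n"
  using assms
proof (induction n arbitrary: c r)
  case 0
  have "\<forall>c<7. \<forall>r<7. c = r \<longleftrightarrow> rounds c r \<le> 0"
    unfolding all_less_code by code_simp
  with 0 show ?case
    by simp
next
  case (Suc n)
  have "c' < 7" if "c' \<in> moves example u" "u < 7" for c' u
    using moves_pverts[OF wf_example _ that(1)] that(2) by (simp add: example_pverts)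
  with Suc have "captures_within example n c' r' \<longleftrightarrow> rounds c' r' \<le> n"
    if "c' \<in> moves example c" "r' \<in> moves example r" for c' r'
    using that by (meson Suc_leD)
  then have "captures_within example (Suc n) c r \<longleftrightarrow> c = r \<or>
      (\<exists>c' \<in> moves example c. c' = r \<or> (\<forall>r' \<in> moves example r. rounds c' r' \<le> n))"
    by simp
  also have "\<dots> \<longleftrightarrow> c = r \<or> (\<exists>c' \<in> set (c # out_neighbours c).
      c' = r \<or> (\<forall>r' \<in> set (r # out_neighbours r). rounds c' r' \<le> n))"
    using Suc.prems by (simp only: moves_example)
  also have "\<dots> \<longleftrightarrow> rounds c r \<le> Suc n"
  proof -
    \<comment> \<open>By evaluation, the table solves the recursion of
      \<open>captures_within\<close> at every level needed.\<close>
    have "\<forall>n<5. \<forall>c<7. \<forall>r<7. (c = r \<or> (\<exists>c' \<in> set (c # out_neighbours c).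
        c' = r \<or> (\<forall>r' \<in> set (r # out_neighbours r). rounds c' r' \<le> n))) \<longleftrightarrow> rounds c r \<le> Suc n"
      unfolding all_less_code by code_simp
    then show ?thesis
      using Suc.prems by (simp only: Suc_le_eq)
  qed
  finally show ?case .
qed

section \<open>The value of the example and the forced route of the cop\<close>

theorem theorem30:
  shows "\<exists>G :: nat pair_pre_digraph. oriented_graph G \<and> cop_win G \<and>
    (\<forall>\<sigma> \<tau>. optimal_cop G \<sigma> \<longrightarrow> optimal_robber G \<tau> \<longrightarrow> cop_revisits \<sigma> \<tau>)"
proof (intro exI conjI allI impI)
  show "oriented_graph example"
    by (fact oriented_example)
  \<comment> \<open>Upper bound on the value: the cop starts at the source.\<close>
  have "\<forall>r<7. rounds 0 r \<le> 5"
    unfolding all_less_code by code_simp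
  then have "captures_within example 5 0 r" if "r \<in> pverts example" for r
    using that by (simp add: captures_within_example example_pverts)
  then obtain \<sigma>0 where \<sigma>0: "\<sigma>0 \<in> cop_strategies example"
    "\<And>\<tau>. \<tau> \<in> robber_strategies example \<Longrightarrow> capture_time \<sigma>0 \<tau> \<le> enat 5"
    using ex_cop_strategy[OF wf_example, of 0 5] by (auto simp: example_def)
  \<comment> \<open>Lower bound: whichever vertex the cop takes, some robber start costs her more
    than 4 rounds.\<close>
  have "\<forall>c<7. \<exists>r<7. \<not> rounds c r \<le> 4"
    unfolding all_less_code ex_less_code by code_simp
  then have "\<exists>r \<in> pverts example. \<not> captures_within example 4 c r" if "c \<in> pverts example" for c
    using that captures_within_example[of 4 c] by (auto simp: example_pverts)
  then obtain \<tau>0 where \<tau>0: "\<tau>0 \<in> robber_strategies example"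
    "\<And>\<sigma>. \<sigma> \<in> cop_strategies example \<Longrightarrow> enat 5 \<le> capture_time \<sigma> \<tau>0"
    using ex_robber_strategy[OF wf_example, of 4] by auto
  show "cop_win example"
    using \<sigma>0 unfolding cop_win_def capture_time_le_iff by blast
  fix \<sigma> \<tau>
  assume "optimal_cop example \<sigma>" "optimal_robber example \<tau>"
  have \<sigma>: "\<sigma> \<in> cop_strategies example" and \<tau>: "\<tau> \<in> robber_strategies example"
    using \<open>optimal_cop example \<sigma>\<close> \<open>optimal_robber example \<tau>\<close>
    by (simp_all add: optimal_cop_def optimal_robber_def)
  have upper: "capture_time \<sigma> \<tau>' \<le> enat 5" if "\<tau>' \<in> robber_strategies example" for \<tau>'
  proof -
    have "capture_time \<sigma> \<tau>' \<le> (SUP \<tau> \<in> robber_strategies example. capture_time \<sigma> \<tau>)"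
      using that by (rule SUP_upper)
    also have "\<dots> \<le> (SUP \<tau> \<in> robber_strategies example. capture_time \<sigma>0 \<tau>)"
      using \<open>optimal_cop example \<sigma>\<close> \<sigma>0(1) by (simp add: optimal_cop_def)
    also have "\<dots> \<le> enat 5"
      by (rule SUP_least) (rule \<sigma>0(2))
    finally show ?thesis .
  qed
  have lower: "enat 5 \<le> capture_time \<sigma>' \<tau>" if "\<sigma>' \<in> cop_strategies example" for \<sigma>'
  proof -
    have "enat 5 \<le> (INF \<sigma> \<in> cop_strategies example. capture_time \<sigma> \<tau>0)"
      by (rule INF_greatest) (rule \<tau>0(2))
    also have "\<dots> \<le> (INF \<sigma> \<in> cop_strategies example. capture_time \<sigma> \<tau>)"
      using \<open>optimal_robber example \<tau>\<close> \<tau>0(1) by (simp add: optimal_robber_def)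
    also have "\<dots> \<le> capture_time \<sigma>' \<tau>"
      using that by (rule INF_lower)
    finally show ?thesis .
  qed
  have no_meet: "\<not> meet \<sigma> \<tau> j" if "j < 5" for j
  proof
    assume "meet \<sigma> \<tau> j"
    then have "capture_time \<sigma> \<tau> \<le> enat j"
      by (auto simp: capture_time_le_iff)
    with lower[OF \<sigma>] have "enat 5 \<le> enat j"
      by (rule order_trans)
    with that show False
      by simp
  qed
  define c r where "c = cop_pos \<sigma> \<tau>" and "r = robber_pos \<sigma> \<tau>"
  have pos: "c k < 7" "r k < 7" for k
    using pos_pverts[OF wf_example \<sigma> \<tau>, of k] by (simp_all add: c_def r_def example_def)
  \<comment> \<open>The two guarantees pinch the table entry: the cop's gives at most
    \<open>5 - k\<close>, the robber's more than \<open>4 - k\<close>.\<close>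
  have rounds_left: "rounds (c k) (r k) = 5 - k" if "k < 5" for k
  proof -
    have "captures_within example (Suc (4 - k)) (c k) (r k)"
      unfolding c_def r_def
      by (rule cop_guarantee[OF wf_example \<sigma> upper \<tau>, of k "4 - k"]) (use that no_meet in auto)
    moreover have "\<not> captures_within example (4 - k) (c k) (r k)"
      unfolding c_def r_def
      by (rule robber_guarantee[OF wf_example \<tau> lower \<sigma>, of k "4 - k"]) (use that in auto)
    ultimately have "rounds (c k) (r k) \<le> Suc (4 - k)" "\<not> rounds (c k) (r k) \<le> 4 - k"
      using captures_within_example[OF _ pos, of _ k k] by (simp_all del: captures_within.simps)
    then show ?thesis
      using that by linarith
  qed
  have c_move: "c j \<in> set (c k # out_neighbours (c k))" if "j = Suc k" for j k
    using cop_pos_Suc[OF wf_example \<sigma> \<tau>, of k] pos moves_example that by (simp add: c_def)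
  \<comment> \<open>Each of these values occurs in at most two rows, so it nearly determines the
    cop's vertex. In rounds 2 and 3 the alternative 0 drops out because no arc enters the
    source.\<close>
  have "\<forall>c<7. \<forall>r<7. (rounds c r = 5 \<longrightarrow> c = 0 \<or> c = 3) \<and> (rounds c r = 4 \<longrightarrow> c = 1) \<and>
      (rounds c r = 3 \<longrightarrow> c = 2 \<or> c = 0) \<and> (rounds c r = 2 \<longrightarrow> (c = 3 \<or> c = 0) \<and> r = 6)"
    unfolding all_less_code by code_simp
  note lookup = this[rule_format, OF pos]
  \<comment> \<open>Starting at \<open>3\<close> is not optimal, but need not be excluded: it leads to a revisit as well.\<close>
  have "c 0 = 0 \<or> c 0 = 3"
    using lookup[of 0 0] rounds_left[of 0] by auto
  have "c 1 = 1"
    using lookup[of 1 1] rounds_left[of 1] by auto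
  have "c 2 = 2"
    using lookup[of 2 2] rounds_left[of 2] c_move[of 2 1] \<open>c 1 = 1\<close> by (auto simp: out_neighbours_def)
  have "c 3 = 3" "r 3 = 6"
    using lookup[of 3 3] rounds_left[of 3] c_move[of 3 2] \<open>c 2 = 2\<close> by (auto simp: out_neighbours_def)
  have "c 4 \<noteq> r 3"
    using no_meet[of 4] meet_Suc[of \<sigma> \<tau> 3] by (simp add: c_def r_def)
  \<comment> \<open>The value 1 of the actual position would still allow \<open>c 4 = 5\<close> with
    the robber staying at 6. Winning against both of his replies, 6 and 4, leaves only the vertex
    1.\<close>
  moreover have "c 4 = r 3 \<or> captures_within example 1 (c 4) r'" if "r' \<in> moves example 6" for r'
    using cop_guarantee_step[OF wf_example \<sigma> upper \<tau>, of 3 1 r'] no_meet that \<open>r 3 = 6\<close>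
    by (simp add: c_def r_def)
  ultimately have "captures_within example 1 (c 4) 6" "captures_within example 1 (c 4) 4"
    by (auto simp: moves_example out_neighbours_def simp del: captures_within.simps One_nat_def)
  then have "rounds (c 4) 6 \<le> 1" "rounds (c 4) 4 \<le> 1"
    using captures_within_example[of 1 "c 4"] pos(1)[of 4]
    by (simp_all del: captures_within.simps One_nat_def)
  then have "c 4 = 1"
    using c_move[of 4 3] \<open>c 3 = 3\<close> by (auto simp: out_neighbours_def rounds_def)
  from \<open>c 0 = 0 \<or> c 0 = 3\<close> show "cop_revisits \<sigma> \<tau>"
  proof
    assume "c 0 = 0"
    have "enat 4 \<le> capture_time \<sigma> \<tau>"
      by (rule order_trans[OF _ lower[OF \<sigma>]]) simp
    then show ?thesis
      unfolding cop_revisits_def c_def[symmetric] using \<open>c 1 = 1\<close> \<open>c 2 = 2\<close> \<open>c 4 = 1\<close>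
      by (intro exI[of _ 1] exI[of _ 2] exI[of _ 4]) simp
  next
    assume "c 0 = 3"
    have "enat 3 \<le> capture_time \<sigma> \<tau>"
      by (rule order_trans[OF _ lower[OF \<sigma>]]) simp
    then show ?thesis
      unfolding cop_revisits_def c_def[symmetric] using \<open>c 0 = 3\<close> \<open>c 1 = 1\<close> \<open>c 3 = 3\<close>
      by (intro exI[of _ 0] exI[of _ 1] exI[of _ 3]) simp
  qed
qed

end
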